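(* Let $m$ be a natural number and let $\Gamma$ be a connected graph in which every vertex has finite degree. If the complete graph $K_m$ on $m$ vertices is not a minor of $\Gamma$, then $\Gamma$ (regarded as its vertex set with the shortest path metric) has Assouad-Nagata dimension at most $4^m-1$.
   Context: Minor: a finite graph $M$ is a minor of a connected graph $\Gamma$ if there is a finite set $\{V_i\}$ of pairwise-disjoint (nonempty) finite connected subgraphs of $\Gamma$ (called branch sets), in one-to-one correspondence with the set of vertices $\{v_i\}$ of $M$, such that for every edge of $M$ between $v_i$ and $v_j$ there is an edge of $\Gamma$ between the corresponding branch sets $V_i$ and $V_j$. Metric: a connected graph is considered as the metric space whose points are its vertices, with the shortest path metric in which each edge has length $1$. Assouad-Nagata dimension: let $X$ be a metric space and $d\in\mathbb{N}$. The Assouad-Nagata dimension of $X$ is at most $d$ if there exists $\gamma\in(0,\infty)$ such that for every real $s>0$ there exists a cover $\mathcal{U}$ of $X$ such that each closed ball of radius $s$ in $X$ intersects at most $d+1$ elements of $\mathcal{U}$, and each element of $\mathcal{U}$ has diameter at most $\gamma\cdot s$. *)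

theory Defs
  imports "HOL-Analysis.Analysis" "Graph_Theory.Graph_Theory"
begin

text \<open>
  A simple undirected graph, possibly infinite: an undirected edge is a pair of opposite arcs.
  This is the library's locale \<^locale>\<open>graph\<close> without its finiteness requirement.
\<close>

locale simple_graph = sym_digraph + loopfree_digraph + nomulti_digraph

lemma (in graph) simple_graph: "simple_graph G"
  by unfold_locales

definition complete_graph :: "nat \<Rightarrow> nat pair_pre_digraph" where
  "complete_graph m = \<lparr>pverts = {..<m}, parcs = {(i, j). i < m \<and> j < m \<and> i \<noteq> j}\<rparr>"

lemma complete_digraph_complete_graph: "complete_digraph m (with_proj (complete_graph m))"
  by (auto simp: complete_digraph_pair_def complete_graph_def)

text \<open>
  The branch sets are indexed by the vertices of \<open>M\<close>; being nonempty and pairwise disjoint, they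
  correspond to them one-to-one.  Nonemptiness is part of the library's
  \<^const>\<open>Digraph_Component.connected\<close>, finiteness is part of \<^const>\<open>graph\<close>.
\<close>

definition minor :: "('c, 'd) pre_digraph \<Rightarrow> ('a, 'b) pre_digraph \<Rightarrow> bool" where
  "minor M G \<longleftrightarrow>
    (\<exists>B :: 'c \<Rightarrow> ('a, 'b) pre_digraph.
      (\<forall>v\<in>verts M. subgraph (B v) G \<and> graph (B v) \<and> Digraph_Component.connected (B v)) \<and>
      (\<forall>v\<in>verts M. \<forall>w\<in>verts M. v \<noteq> w \<longrightarrow> verts (B v) \<inter> verts (B w) = {}) \<and>
      (\<forall>v w. v \<rightarrow>\<^bsub>M\<^esub> w \<longrightarrow> (\<exists>x\<in>verts (B v). \<exists>y\<in>verts (B w). x \<rightarrow>\<^bsub>G\<^esub> y)))"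

text \<open>
  The infimum \<^const>\<open>wf_digraph.\<mu>\<close> of the walk lengths is infinite for vertices that are not
  joined by a walk; such pairs get the junk value \<open>0\<close>, which never happens between
  vertices of a connected graph.
\<close>

definition graph_dist :: "('a, 'b) pre_digraph \<Rightarrow> 'a \<Rightarrow> 'a \<Rightarrow> real" where
  "graph_dist G u v = real_of_ereal (wf_digraph.\<mu> G (\<lambda>_. 1) u v)"

text \<open>
  The diameter bound is stated pairwise: a real-valued supremum of distances has no meaning for
  unbounded sets.
\<close>

definition (in Metric_space) assouad_nagata_dim_le :: "nat \<Rightarrow> bool" where
  "assouad_nagata_dim_le n \<longleftrightarrow>
    (\<exists>\<gamma>>0. \<forall>s>0. \<exists>\<U>. \<Union>\<U> = M \<and>
      (\<forall>x\<in>M. finite {U\<in>\<U>. U \<inter> mcball x s \<noteq> {}} \<and>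
              card {U\<in>\<U>. U \<inter> mcball x s \<noteq> {}} \<le> n + 1) \<and>
      (\<forall>U\<in>\<U>. \<forall>x\<in>U. \<forall>y\<in>U. d x y \<le> \<gamma> * s))"

lemma (in wf_digraph) awalk_cost_one: "awalk_cost (\<lambda>_. 1) p = real (length p)"
  by (induction p) auto

lemma (in wf_digraph) graph_dist_le:
  assumes "awalk u p v"
  shows "graph_dist G u v \<le> real (length p)"
proof -
  have "\<mu> (\<lambda>_. 1) u v \<le> ereal (real (length p))"
    using min_cost_le_walk_cost[OF assms, of "\<lambda>_. 1"] by (simp add: awalk_cost_one)
  moreover have "0 \<le> \<mu> (\<lambda>_. 1) u v"
    unfolding \<mu>_def by (rule INF_greatest) (simp add: awalk_cost_one)
  ultimately show ?thesis
    unfolding graph_dist_def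
    by (cases "\<mu> (\<lambda>_. 1) u v") auto
qed

lemma (in wf_digraph) graph_dist_nonneg: "0 \<le> graph_dist G u v"
proof -
  have "0 \<le> \<mu> (\<lambda>_. 1) u v"
    unfolding \<mu>_def by (rule INF_greatest) (simp add: awalk_cost_one)
  then show ?thesis
    unfolding graph_dist_def by (rule real_of_ereal_pos)
qed

lemma (in wf_digraph) graph_dist_attained:
  assumes "u \<rightarrow>\<^sup>* v"
  obtains p where "awalk u p v" "graph_dist G u v = real (length p)"
proof -
  obtain q where "awalk u q v"
    using assms by (auto simp: reachable_awalk)
  then obtain p where p: "awalk u p v" and least: "\<And>q. awalk u q v \<Longrightarrow> length p \<le> length q"
    using ex_has_least_nat[of "\<lambda>p. awalk u p v" q length] by blast
  have "\<mu> (\<lambda>_. 1) u v = ereal (real (length p))"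
    unfolding \<mu>_def
    by (rule antisym[OF INF_lower2 INF_greatest]) (use p least in \<open>auto simp: awalk_cost_one\<close>)
  with p show ?thesis
    by (intro that) (auto simp: graph_dist_def)
qed

lemma (in simple_graph) awalk_reverse:
  assumes "awalk u p v"
  shows "\<exists>q. awalk v q u \<and> length q = length p"
  using assms
proof (induction p arbitrary: u)
  case Nil
  then show ?case by (auto intro!: exI[of _ "[]"] simp: awalk_Nil_iff)
next
  case (Cons e p)
  then obtain q where q: "awalk v q (head G e)" "length q = length p" and e: "e \<in> arcs G" "tail G e = u"
    by (auto simp: awalk_Cons_iff)
  obtain e' where e': "e' \<in> arcs G" "tail G e' = head G e" "head G e' = u"
    using e sym_arcs unfolding symmetric_conv by metis
  then have "awalk (head G e) [e'] u"
    using arc_implies_awalk[of e'] by simp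
  with q show ?case
    by (intro exI[of _ "q @ [e']"]) (auto simp: awalk_appendI)
qed

lemma (in simple_graph) graph_dist_commute: "graph_dist G u v = graph_dist G v u"
proof -
  have le: "graph_dist G x y \<le> graph_dist G y x" if "y \<rightarrow>\<^sup>* x" for x y
    using that by (metis graph_dist_attained awalk_reverse graph_dist_le)
  show ?thesis
  proof (cases "u \<rightarrow>\<^sup>* v")
    case True
    then have "v \<rightarrow>\<^sup>* u"
      by (rule symmetric_reachable[OF sym_arcs])
    with True show ?thesis
      by (intro antisym le)
  next
    case False
    then have "\<not> v \<rightarrow>\<^sup>* u"
      using symmetric_reachable[OF sym_arcs, of v u] by argo
    with False show ?thesis by (simp add: graph_dist_def shortest_path_inf)
  qed
qed

lemma (in simple_graph) Metric_space_graph_dist: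
  assumes "Digraph_Component.connected G"
  shows "Metric_space (verts G) (graph_dist G)"
proof
  have reach: "u \<rightarrow>\<^sup>* v" if "u \<in> verts G" "v \<in> verts G" for u v
    using symmetric_connected_imp_strongly_connected[OF sym_arcs assms] that
    by (auto simp: strongly_connected_def)
  show "0 \<le> graph_dist G x y" for x y
    by (rule graph_dist_nonneg)
  show "graph_dist G x y = graph_dist G y x" for x y
    by (rule graph_dist_commute)
  show "graph_dist G x y = 0 \<longleftrightarrow> x = y" if xy: "x \<in> verts G" "y \<in> verts G" for x y
  proof
    assume "graph_dist G x y = 0"
    then show "x = y"
      using graph_dist_attained[OF reach[OF xy]] by (metis awalk_empty_ends length_0_conv of_nat_eq_0_iff)
  next
    assume "x = y"
    then show "graph_dist G x y = 0"
      using graph_dist_le[of x "[]" x] graph_dist_nonneg[of x x] xy by (simp add: awalk_Nil_iff)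
  qed
  show "graph_dist G x z \<le> graph_dist G x y + graph_dist G y z"
    if xyz: "x \<in> verts G" "y \<in> verts G" "z \<in> verts G" for x y z
  proof -
    obtain p where p: "awalk x p y" "graph_dist G x y = real (length p)"
      using graph_dist_attained reach xyz by blast
    obtain q where q: "awalk y q z" "graph_dist G y z = real (length q)"
      using graph_dist_attained reach xyz by blast
    show ?thesis
      using graph_dist_le[OF awalk_appendI[OF p(1) q(1)]] p q by simp
  qed
qed

end

theory Submission
  imports Defs
begin

text \<open>
  The cover comes from the iterated chopping of Klein, Plotkin and Rao.  A connected piece is cut
  into annuli around a root, and the components of the annuli are the pieces of the next level.
  Consecutive annuli overlap by \<open>2s\<close>, so that every \<open>s\<close>-ball stays inside some piece while each
  level at most doubles the number of pieces containing a vertex.  After \<open>m - 1\<close> levels, shrinking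
  every piece by \<open>s\<close> gives a cover in which an \<open>s\<close>-ball meets at most \<open>2 ^ (m - 1)\<close> sets.

  The pieces have diameter \<open>O(m\<^sup>2 s)\<close> in \<open>\<Gamma>\<close>: otherwise one of them contains \<open>m\<close> vertices far
  apart from each other, and \<open>K\<^sub>m\<close> is built from them by undoing the choppings, following
  Fakcharoenphol and Talwar.  Each branch set carries a representative that is far from the other
  branch sets in the current piece.  Undoing a chopping, the branch sets are prolonged along
  geodesics from their representatives towards the root, to some distance beyond the annulus, and a
  ball around the root becomes the new branch set; the new representatives lie in the middle of
  the prolongations.
\<close>

section \<open>Walks, hop distance and geodesics inside a vertex set\<close>

text \<open>The vertex set is a parameter because the intrinsic metrics of many nested sets over one
  relation are compared; enlarging the set can only shorten distances.\<close>

primrec walk :: "('a \<Rightarrow> 'a \<Rightarrow> bool) \<Rightarrow> 'a set \<Rightarrow> nat \<Rightarrow> 'a \<Rightarrow> 'a \<Rightarrow> bool" where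
  "walk E X 0 x y \<longleftrightarrow> x \<in> X \<and> x = y"
| "walk E X (Suc n) x y \<longleftrightarrow> x \<in> X \<and> (\<exists>z. E x z \<and> walk E X n z y)"

text \<open>Unspecified when \<open>X\<close> contains no walk from \<open>x\<close> to \<open>y\<close>.\<close>

definition hops :: "('a \<Rightarrow> 'a \<Rightarrow> bool) \<Rightarrow> 'a set \<Rightarrow> 'a \<Rightarrow> 'a \<Rightarrow> nat" where
  "hops E X x y = (LEAST n. walk E X n x y)"

definition conn :: "('a \<Rightarrow> 'a \<Rightarrow> bool) \<Rightarrow> 'a set \<Rightarrow> bool" where
  "conn E X \<longleftrightarrow> (\<forall>x\<in>X. \<forall>y\<in>X. \<exists>n. walk E X n x y)"

lemma walk_in: "walk E X n x y \<Longrightarrow> x \<in> X \<and> y \<in> X"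
  by (induction n arbitrary: x) auto

lemma walk_append: "walk E X k x y \<Longrightarrow> walk E X n y z \<Longrightarrow> walk E X (k + n) x z"
  by (induction k arbitrary: x) auto

lemma walk_edge: "E x y \<Longrightarrow> x \<in> X \<Longrightarrow> y \<in> X \<Longrightarrow> walk E X 1 x y"
  by auto

lemma walk_mono: "walk E X n x y \<Longrightarrow> X \<subseteq> Y \<Longrightarrow> walk E Y n x y"
  by (induction n arbitrary: x) auto

text \<open>Every vertex on the walk is itself reached from \<open>x\<close> in at most
  \<open>n\<close> steps, so bounding all such vertices confines the walk without naming its
  vertices.\<close>

lemma walk_range:
  assumes "walk E X n x y" "\<And>k z. k \<le> n \<Longrightarrow> walk E X k x z \<Longrightarrow> z \<in> Y"
  shows "walk E Y n x y"
  using assms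
proof (induction n arbitrary: x)
  case (Suc n)
  obtain z where z: "E x z" "walk E X n z y" and x: "x \<in> X"
    using Suc.prems by auto
  have "walk E Y n z y"
  proof (rule Suc.IH[OF z(2)])
    fix k w assume "k \<le> n" "walk E X k z w"
    then show "w \<in> Y"
      using Suc.prems(2)[of "Suc k" w] z x by auto
  qed
  with z x Suc.prems(2)[of 0 x] show ?case by auto
next
  case 0
  then show ?case by fastforce
qed

lemma hops_le: "walk E X n x y \<Longrightarrow> hops E X x y \<le> n"
  unfolding hops_def by (rule Least_le)

lemma hops_walk:
  assumes "conn E X" "x \<in> X" "y \<in> X"
  shows "walk E X (hops E X x y) x y"
proof -
  have "\<exists>n. walk E X n x y"
    using assms by (auto simp: conn_def)
  then show ?thesis
    unfolding hops_def by (rule LeastI_ex)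
qed

lemma hops_self [simp]: "x \<in> X \<Longrightarrow> hops E X x x = 0"
  using hops_le[of E X 0 x x] by simp

lemma hops_eq_0: "conn E X \<Longrightarrow> x \<in> X \<Longrightarrow> y \<in> X \<Longrightarrow> hops E X x y = 0 \<Longrightarrow> x = y"
  using hops_walk[of E X x y] by simp

lemma hops_triangle:
  assumes "conn E X" "x \<in> X" "y \<in> X" "z \<in> X"
  shows "hops E X x z \<le> hops E X x y + hops E X y z"
  using assms by (intro hops_le walk_append[OF hops_walk hops_walk]) auto

lemma hops_walk_le:
  assumes "conn E X" "x \<in> X" "walk E X n y z"
  shows "hops E X x z \<le> hops E X x y + n"
  using assms walk_in[OF assms(3)] by (intro hops_le walk_append[OF hops_walk]) auto

lemma hops_antimono:
  assumes "conn E X" "X \<subseteq> Y" "x \<in> X" "y \<in> X"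
  shows "hops E Y x y \<le> hops E X x y"
  using assms by (intro hops_le walk_mono[OF hops_walk]) auto

lemma path_walk:
  fixes p :: "nat \<Rightarrow> 'a"
  assumes "\<And>k. i \<le> k \<Longrightarrow> k < i + n \<Longrightarrow> E (p k) (p (Suc k))"
    and "\<And>k. i \<le> k \<Longrightarrow> k \<le> i + n \<Longrightarrow> p k \<in> X"
  shows "walk E X n (p i) (p (i + n))"
  using assms
proof (induction n arbitrary: i)
  case (Suc n)
  have "walk E X n (p (Suc i)) (p (Suc i + n))"
    by (rule Suc.IH) (use Suc.prems in auto)
  moreover have "E (p i) (p (Suc i))" "p i \<in> X"
    using Suc.prems by auto
  ultimately show ?case by auto
qed auto

definition geodesic :: "('a \<Rightarrow> 'a \<Rightarrow> bool) \<Rightarrow> 'a set \<Rightarrow> 'a \<Rightarrow> 'a \<Rightarrow> (nat \<Rightarrow> 'a) \<Rightarrow> bool" where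
  "geodesic E X x y p \<longleftrightarrow> p (hops E X x y) = y \<and>
    (\<forall>i\<le>hops E X x y. p i \<in> X \<and> hops E X x (p i) = i) \<and>
    (\<forall>i<hops E X x y. E (p i) (p (Suc i)))"

lemma geodesic_exists:
  assumes "conn E X" "x \<in> X" "y \<in> X"
  shows "\<exists>p. geodesic E X x y p"
proof -
  have *: "\<exists>p. p 0 = u \<and> p n = v \<and> (\<forall>i\<le>n. p i \<in> X) \<and> (\<forall>i<n. E (p i) (p (Suc i)))"
    if "walk E X n u v" for n u v
    using that
  proof (induction n arbitrary: u)
    case 0
    then show ?case by (auto intro!: exI[of _ "\<lambda>_. u"])
  next
    case (Suc n)
    then obtain z p where z: "E u z" "u \<in> X"
      and p: "p 0 = z" "p n = v" "\<forall>i\<le>n. p i \<in> X" "\<forall>i<n. E (p i) (p (Suc i))"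
      by (metis walk.simps(2))
    have "E (case_nat u p i) (p i)" if "i < Suc n" for i
      using that z p by (cases i) auto
    then show ?case
      using z p by (intro exI[of _ "case_nat u p"]) (auto split: nat.splits)
  qed
  define n where "n = hops E X x y"
  obtain p where p: "p 0 = x" "p n = y" "\<And>i. i \<le> n \<Longrightarrow> p i \<in> X" "\<And>i. i < n \<Longrightarrow> E (p i) (p (Suc i))"
    using *[OF hops_walk[OF assms]] n_def by metis
  have seg: "walk E X j (p i) (p (i + j))" if "i + j \<le> n" for i j
    by (rule path_walk) (use p that in auto)
  have "hops E X x (p i) = i" if "i \<le> n" for i
  proof (rule antisym)
    show "hops E X x (p i) \<le> i"
      using hops_le[OF seg[of 0 i]] p that by simp
    \<comment> \<open>A shorter way to \<open>p i\<close>, continued along the rest of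
      \<open>p\<close>, would beat the shortest walk to \<open>y\<close>.\<close>
    have "n \<le> hops E X x (p i) + (n - i)"
      using hops_walk_le[OF assms(1,2) seg[of i "n - i"]] p that by (simp add: n_def)
    then show "i \<le> hops E X x (p i)"
      using that by simp
  qed
  then show ?thesis
    unfolding geodesic_def by (intro exI[of _ p]) (use p in \<open>auto simp: n_def\<close>)
qed

lemma geodesic_hops:
  assumes "geodesic E X x y p" "i \<le> j" "j \<le> hops E X x y"
  shows "hops E X (p i) (p j) \<le> j - i"
proof -
  have "walk E X (j - i) (p i) (p (i + (j - i)))"
    by (rule path_walk) (use assms in \<open>auto simp: geodesic_def\<close>)
  then show ?thesis
    using assms by (intro hops_le) simp
qed

section \<open>Choppings, clique models and the pieces of the cover\<close>

text \<open>The first clause on the root \<open>x\<close> puts \<open>Y\<close> into an annulus of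
  \<open>Suc \<Delta>\<close> distance layers, the second closes \<open>Y\<close> under adjacency
  there. For symmetric \<open>E\<close>, a connected such \<open>Y\<close> is a component of the
  annulus or empty.\<close>

definition chop :: "('a \<Rightarrow> 'a \<Rightarrow> bool) \<Rightarrow> nat \<Rightarrow> 'a set \<Rightarrow> 'a set \<Rightarrow> bool" where
  "chop E \<Delta> X Y \<longleftrightarrow> conn E Y \<and> Y \<subseteq> X \<and>
    (\<exists>x\<in>X. \<exists>a. (\<forall>y\<in>Y. hops E X x y \<in> {a..a + \<Delta>}) \<and>
      (\<forall>y\<in>Y. \<forall>z\<in>X. E y z \<and> hops E X x z \<in> {a..a + \<Delta>} \<longrightarrow> z \<in> Y))"

lemma chops_subset: "(chop E \<Delta> ^^ n) X Y \<Longrightarrow> Y \<subseteq> X"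
  by (induction n arbitrary: Y) (fastforce simp: chop_def)+

lemma chops_conn: "(chop E \<Delta> ^^ n) X Y \<Longrightarrow> conn E X \<Longrightarrow> conn E Y"
  by (induction n arbitrary: Y) (fastforce simp: chop_def)+

text \<open>There are \<open>Suc n\<close> branch sets. The separation uses the intrinsic metric of
  \<open>X\<close>: when the chopping that produced \<open>X\<close> is undone, this is what keeps
  the prolongation of one branch set from hitting another.\<close>

definition rooted_clique_model ::
    "('a \<Rightarrow> 'a \<Rightarrow> bool) \<Rightarrow> nat \<Rightarrow> 'a set \<Rightarrow> nat \<Rightarrow> (nat \<Rightarrow> 'a set) \<Rightarrow> (nat \<Rightarrow> 'a) \<Rightarrow> bool" where
  "rooted_clique_model E \<Delta> X n A v \<longleftrightarrow>
    (\<forall>j\<le>n. finite (A j) \<and> A j \<subseteq> X \<and> conn E (A j) \<and> v j \<in> A j) \<and>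
    (\<forall>i\<le>n. \<forall>j\<le>n. i \<noteq> j \<longrightarrow>
      A i \<inter> A j = {} \<and> (\<exists>x\<in>A i. \<exists>y\<in>A j. E x y) \<and> (\<forall>y\<in>A j. \<Delta> < hops E X (v i) y))"

definition component :: "('a \<Rightarrow> 'a \<Rightarrow> bool) \<Rightarrow> 'a set \<Rightarrow> 'a \<Rightarrow> 'a set" where
  "component E X x = {y. \<exists>n. walk E X n x y}"

text \<open>For positive \<sigma> an annulus has \<open>2 * \<sigma>\<close> layers while the
  starting layers are \<sigma> apart, so every layer lies in at most two annuli.\<close>

definition annulus :: "('a \<Rightarrow> 'a \<Rightarrow> bool) \<Rightarrow> 'a set \<Rightarrow> nat \<Rightarrow> nat \<Rightarrow> 'a set" where
  "annulus E X \<sigma> k = {y\<in>X. hops E X (SOME x. x \<in> X) y \<in> {k * \<sigma>..k * \<sigma> + (2 * \<sigma> - 1)}}"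

primrec pieces :: "('a \<Rightarrow> 'a \<Rightarrow> bool) \<Rightarrow> 'a set \<Rightarrow> nat \<Rightarrow> nat \<Rightarrow> 'a set set" where
  "pieces E V \<sigma> 0 = {V}"
| "pieces E V \<sigma> (Suc n) =
    {component E (annulus E X \<sigma> k) y | X k y. X \<in> pieces E V \<sigma> n \<and> y \<in> annulus E X \<sigma> k}"

section \<open>Connectedness and finite balls under symmetry and finite degree\<close>

locale locally_finite_relation =
  fixes E :: "'a \<Rightarrow> 'a \<Rightarrow> bool"
  assumes sym: "E x y \<Longrightarrow> E y x"
    and finite_neighbours: "finite {y. E x y}"
begin

lemma walk_sym: "walk E X n x y \<Longrightarrow> walk E X n y x"
proof (induction n arbitrary: x)
  case (Suc n)
  then obtain z where "E x z" "walk E X n z y" "x \<in> X" by auto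
  then have "walk E X n y z" "walk E X 1 z x"
    using Suc.IH sym by (auto dest: walk_in)
  then show ?case
    using walk_append[of E X n y z 1 x] by simp
qed auto

lemma hops_sym: "hops E X x y = hops E X y x"
proof -
  have "walk E X n x y \<longleftrightarrow> walk E X n y x" for n
    by (auto dest: walk_sym)
  then show ?thesis
    by (simp add: hops_def)
qed

lemma conn_if_centre:
  assumes "\<And>y. y \<in> X \<Longrightarrow> \<exists>n. walk E X n x y"
  shows "conn E X"
  unfolding conn_def
proof (intro ballI)
  fix y z assume "y \<in> X" "z \<in> X"
  then obtain k n where "walk E X k x y" "walk E X n x z"
    using assms by metis
  then show "\<exists>n. walk E X n y z"
    using walk_append[OF walk_sym] by metis
qed

lemma conn_Un:
  assumes "conn E X" "conn E Y" "z \<in> X" "z \<in> Y"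
  shows "conn E (X \<union> Y)"
proof (rule conn_if_centre[of _ z])
  fix y assume "y \<in> X \<union> Y"
  then have "(\<exists>n. walk E X n z y) \<or> (\<exists>n. walk E Y n z y)"
    using assms by (auto simp: conn_def)
  then show "\<exists>n. walk E (X \<union> Y) n z y"
    using walk_mono[of E X _ z y "X \<union> Y"] walk_mono[of E Y _ z y "X \<union> Y"] by blast
qed

lemma conn_path:
  fixes p :: "nat \<Rightarrow> 'a"
  assumes "\<And>i. b \<le> i \<Longrightarrow> i < c \<Longrightarrow> E (p i) (p (Suc i))"
  shows "conn E (p ` {b..c})"
proof (rule conn_if_centre[of _ "p b"])
  fix y assume "y \<in> p ` {b..c}"
  then obtain i where i: "b \<le> i" "i \<le> c" "y = p i" by auto
  have "walk E (p ` {b..c}) (i - b) (p b) (p (b + (i - b)))"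
    by (rule path_walk) (use assms i in auto)
  then show "\<exists>n. walk E (p ` {b..c}) n (p b) y"
    using i by auto
qed

lemma finite_walks: "finite {y. \<exists>k\<le>n. walk E X k x y}"
proof (induction n arbitrary: x)
  case (Suc n)
  have "{y. \<exists>k\<le>Suc n. walk E X k x y} \<subseteq> insert x (\<Union>z\<in>{z. E x z}. {y. \<exists>k\<le>n. walk E X k z y})"
  proof
    fix y assume "y \<in> {y. \<exists>k\<le>Suc n. walk E X k x y}"
    then obtain k where "k \<le> Suc n" "walk E X k x y" by auto
    then show "y \<in> insert x (\<Union>z\<in>{z. E x z}. {y. \<exists>k\<le>n. walk E X k z y})"
      by (cases k) auto
  qed
  then show ?case
    by (rule finite_subset) (use Suc finite_neighbours in auto)
next
  case 0
  have "{y. \<exists>k\<le>0. walk E X k x y} \<subseteq> {x}" by auto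
  then show ?case by (rule finite_subset) simp
qed

lemma finite_ball: "conn E X \<Longrightarrow> x \<in> X \<Longrightarrow> finite {y\<in>X. hops E X x y \<le> n}"
  by (rule finite_subset[OF _ finite_walks[of n X x]]) (blast intro: hops_walk)

lemma conn_ball:
  assumes "conn E X" "x \<in> X"
  shows "conn E {y\<in>X. hops E X x y \<le> n}"
proof (rule conn_if_centre[of _ x])
  fix y assume y: "y \<in> {y\<in>X. hops E X x y \<le> n}"
  have "walk E X (hops E X x y) x y"
    using assms y by (intro hops_walk) auto
  then have "walk E {y\<in>X. hops E X x y \<le> n} (hops E X x y) x y"
  proof (rule walk_range)
    fix k z assume "k \<le> hops E X x y" "walk E X k x z"
    then show "z \<in> {y\<in>X. hops E X x y \<le> n}"
      using y hops_le[of E X k x z] walk_in[of E X k x z] by auto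
  qed
  then show "\<exists>k. walk E {y\<in>X. hops E X x y \<le> n} k x y" by blast
qed

section \<open>Clique models from iterated choppings\<close>

text \<open>With \<open>R = Suc \<Delta>\<close>, tails along the geodesics have length at most
  \<open>3 * R\<close>, so representatives \<open>8 * R\<close> apart have tails more than
  \<open>R\<close> apart. The tails end next to a ball around the root, which is the additional
  branch set; \<open>u\<close> only serves to find a representative in that ball. Distances in
  \<open>V\<close> bound those in \<open>X\<close> from below, so \<open>far\<close> can be stated
  in the fixed metric of \<open>V\<close>.\<close>

lemma rooted_clique_model_extend:
  assumes V: "conn E V" "X \<subseteq> V" and X: "conn E X" and Z: "chop E \<Delta> X Z"
    and model: "rooted_clique_model E \<Delta> Z n A v"
    and u: "u \<in> Z"
    and far: "\<And>i j. i \<le> n \<Longrightarrow> j \<le> n \<Longrightarrow> i \<noteq> j \<Longrightarrow> 8 * Suc \<Delta> \<le> hops E V (v i) (v j)"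
      "8 * Suc \<Delta> \<le> hops E V (v 0) u"
  shows "\<exists>A' v'. rooted_clique_model E \<Delta> X (Suc n) A' v' \<and>
    (\<forall>j\<le>n. hops E V (v j) (v' j) \<le> 4 * Suc \<Delta>) \<and> hops E V u (v' (Suc n)) \<le> 4 * Suc \<Delta>"
proof -
  define R where "R = Suc \<Delta>"
  obtain x a where x: "x \<in> X" and ZX: "Z \<subseteq> X"
    and Za: "\<And>y. y \<in> Z \<Longrightarrow> hops E X x y \<in> {a..a + \<Delta>}"
    and Zc: "\<And>y z. y \<in> Z \<Longrightarrow> z \<in> X \<Longrightarrow> E y z \<Longrightarrow> hops E X x z \<in> {a..a + \<Delta>} \<Longrightarrow> z \<in> Z"
    using Z unfolding chop_def by metis
  define h where "h = hops E X x"
  have A: "finite (A j)" "A j \<subseteq> Z" "conn E (A j)" "v j \<in> A j" "v j \<in> Z" "v j \<in> X" if "j \<le> n" for j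
    using model that ZX by (auto simp: rooted_clique_model_def)
  have AA: "A i \<inter> A j = {}" "\<exists>x\<in>A i. \<exists>y\<in>A j. E x y" "\<And>y. y \<in> A j \<Longrightarrow> \<Delta> < hops E Z (v i) y"
    if "i \<le> n" "j \<le> n" "i \<noteq> j" for i j
    using model that by (auto simp: rooted_clique_model_def)
  have tri: "hops E X p r \<le> hops E X p q + hops E X q r" if "p \<in> X" "q \<in> X" "r \<in> X" for p q r
    using hops_triangle[OF X] that by auto
  have le: "hops E V p q \<le> hops E X p q" if "p \<in> X" "q \<in> X" for p q
    using hops_antimono[OF X V(2)] that by auto
  have hZ: "a \<le> h y" "h y \<le> a + \<Delta>" if "y \<in> Z" for y
    using Za[OF that] by (auto simp: h_def)
  have uX: "u \<in> X" using u ZX by auto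
  \<comment> \<open>Two points of the annulus that are far apart force it away from the root: the
    detour through \<open>x\<close> has length at most \<open>2 * a + 2 * R\<close>.\<close>
  have "8 * R \<le> hops E X (v 0) u"
    using far(2) le[of "v 0" u] A(6)[of 0] uX by (simp add: R_def)
  also have "\<dots> \<le> h (v 0) + h u"
    using tri[of "v 0" x u] hops_sym[of X x "v 0"] x A(6)[of 0] uX by (simp add: h_def)
  also have "\<dots> \<le> 2 * a + 2 * R"
    using hZ[OF u] hZ[OF A(5)[of 0]] by (simp add: R_def)
  finally have a: "3 * R \<le> a" by simp
  have R: "0 < R" "\<Delta> < R" by (auto simp: R_def)
  \<comment> \<open>The ball ends at level \<open>c\<close>. Level \<open>c + R\<close> is
    \<open>R\<close> away from both the ball and the annulus, which starts at
    \<open>c + 2 * R\<close>; level \<open>c - R\<close> is more than \<open>R\<close> below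
    everything outside the ball. These two levels host the new representatives.\<close>
  define c where "c = a - 2 * R"
  have c: "a = c + 2 * R" "R \<le> c" using a by (auto simp: c_def)

  have "\<exists>p. geodesic E X x (v j) p" if "j \<le> n" for j
    using geodesic_exists[OF X x A(6)] that by auto
  then obtain p where p: "\<And>j. j \<le> n \<Longrightarrow> geodesic E X x (v j) (p j)"
    by metis
  obtain q where q: "geodesic E X x u q"
    using geodesic_exists[OF X x uX] by auto
  have pj: "p j (h (v j)) = v j" "\<And>i. i \<le> h (v j) \<Longrightarrow> p j i \<in> X \<and> h (p j i) = i"
    "\<And>i. i < h (v j) \<Longrightarrow> E (p j i) (p j (Suc i))" if "j \<le> n" for j
    using p[OF that] by (auto simp: geodesic_def h_def)
  have q': "q (h u) = u" "\<And>i. i \<le> h u \<Longrightarrow> q i \<in> X \<and> h (q i) = i"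
    using q by (auto simp: geodesic_def h_def)

  \<comment> \<open>Starting at \<open>Suc c\<close> makes the tail disjoint from the ball, while
    \<open>p j c\<close> lies in the ball and provides the edge between them.\<close>
  define T where "T j = p j ` {Suc c..h (v j)}" for j
  define A' where "A' j = (if j \<le> n then A j \<union> T j else {y\<in>X. h y \<le> c})" for j
  define v' where "v' j = (if j \<le> n then p j (c + R) else q (c - R))" for j

  have T: "y \<in> X" "c < h y" "h y \<le> h (v j)" "hops E X (v j) y \<le> 3 * R"
    if yT: "y \<in> T j" and "j \<le> n" for y j
  proof -
    obtain i where "i \<in> {Suc c..h (v j)}" "y = p j i"
      using yT unfolding T_def by blast
    then have i: "c < i" "i \<le> h (v j)" "y = p j i" by auto
    then show "y \<in> X" "c < h y" "h y \<le> h (v j)"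
      using pj[OF that(2)] by auto
    have "hops E X y (v j) \<le> h (v j) - i"
      using geodesic_hops[OF p[OF that(2)], of i "h (v j)"] i pj(1)[OF that(2)] by (simp add: h_def)
    then show "hops E X (v j) y \<le> 3 * R"
      using hops_sym[of X y "v j"] hZ(2)[OF A(5)[OF that(2)]] i R c by simp
  qed
  have v'T: "v' j \<in> T j" "h (v' j) = c + R" "v j \<in> T j" "v' j \<in> X" if "j \<le> n" for j
  proof -
    have "a \<le> h (v j)" using hZ(1)[OF A(5)[OF that]] .
    then have r: "c + R \<in> {Suc c..h (v j)}" "h (v j) \<in> {Suc c..h (v j)}"
      using R c by auto
    then show "v' j \<in> T j" "h (v' j) = c + R" "v' j \<in> X"
      using that pj(2)[OF that, of "c + R"] by (auto simp: v'_def T_def)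
    show "v j \<in> T j"
      unfolding T_def using r(2) by (rule rev_image_eqI) (simp add: pj(1)[OF that])
  qed
  \<comment> \<open>Going down from \<open>v j\<close>, the geodesic stays in the annulus until
    level \<open>a\<close>, and \<open>Z\<close> is closed under adjacency in the annulus.\<close>
  have pZ: "p j i \<in> Z" if "j \<le> n" "a \<le> i" "i \<le> h (v j)" for i j
    using that(3,2)
  proof (induction rule: inc_induct)
    case base
    then show ?case using pj[OF that(1)] A(5)[OF that(1)] by simp
  next
    case (step k)
    then have "p j (Suc k) \<in> Z" "E (p j (Suc k)) (p j k)" "p j k \<in> X" "h (p j k) = k"
      using pj[OF that(1)] sym by auto
    with Zc[of "p j (Suc k)" "p j k"] show ?case
      using step hZ(2)[OF A(5)[OF that(1)]] by (auto simp: h_def)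
  qed
  text \<open>A tail leaves the annulus within \<open>\<Delta>\<close> steps, all of them inside \<open>Z\<close>.\<close>
  have TA: "y \<notin> A l" if yT: "y \<in> T j" and "j \<le> n" "l \<le> n" "j \<noteq> l" for y j l
  proof
    assume y: "y \<in> A l"
    then have "a \<le> h y" using A(2)[OF that(3)] hZ(1) by auto
    moreover obtain i where "i \<in> {Suc c..h (v j)}" "y = p j i"
      using yT unfolding T_def by blast
    then have i: "i \<le> h (v j)" "y = p j i" by auto
    ultimately have "a \<le> i" using pj(2)[OF that(2)] by auto
    have "walk E Z (h (v j) - i) (p j i) (p j (i + (h (v j) - i)))"
      by (rule path_walk) (use pZ[OF that(2)] pj[OF that(2)] i \<open>a \<le> i\<close> in auto)
    then have "hops E Z y (v j) \<le> h (v j) - i"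
      using i pj(1)[OF that(2)] by (intro hops_le) auto
    then have "hops E Z (v j) y \<le> \<Delta>"
      using hops_sym[of Z y "v j"] hZ(2)[OF A(5)[OF that(2)]] \<open>a \<le> i\<close> by simp
    then show False
      using AA(3)[OF that(2-4) y] by simp
  qed
  have far': "8 * R \<le> hops E X (v i) (v j)" if "i \<le> n" "j \<le> n" "i \<noteq> j" for i j
    using far(1)[OF that] le[OF A(6) A(6)] that unfolding R_def by (meson le_trans)
  \<comment> \<open>Removing the two tail lengths, at most \<open>3 * R\<close> each, from
    \<open>8 * R\<close> leaves \<open>2 * R\<close>. Disjointness of the tails is the case
    \<open>y = z\<close>.\<close>
  have TT: "R < hops E X y z" if "y \<in> T i" "z \<in> T j" "i \<le> n" "j \<le> n" "i \<noteq> j" for y z i j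
    using far'[OF that(3-5)] T(4)[OF that(1,3)] T(4)[OF that(2,4)] R
      tri[of "v i" y "v j"] tri[of y z "v j"] T(1)[OF that(1,3)] T(1)[OF that(2,4)]
      A(6)[OF that(3)] A(6)[OF that(4)] hops_sym[of X z "v j"]
    by linarith
  have hA': "c < h y" "y \<in> X" if "y \<in> A' j" "j \<le> n" for y j
    using that A(2)[OF that(2)] hZ(1) T(1,2) c R ZX by (fastforce simp: A'_def)+
  have new: "A' (Suc n) = {y\<in>X. h y \<le> c}" "v' (Suc n) = q (c - R)"
    by (auto simp: A'_def v'_def)
  have qX: "q (c - R) \<in> X" "h (q (c - R)) = c - R"
    using q'(2)[of "c - R"] hZ(1)[OF u] c by auto

  have fin: "finite (A' j)" "A' j \<subseteq> X" "conn E (A' j)" "v' j \<in> A' j" if "j \<le> Suc n" for j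
  proof -
    have "finite (A' j) \<and> A' j \<subseteq> X \<and> conn E (A' j) \<and> v' j \<in> A' j"
    proof (cases "j \<le> n")
      case True
      have "conn E (T j)"
        unfolding T_def by (rule conn_path) (use pj[OF True] in auto)
      then have "conn E (A j \<union> T j)"
        using conn_Un A(3,4)[OF True] v'T(3)[OF True] by blast
      then show ?thesis
        using True A(1)[OF True] v'T(1)[OF True] hA'(2)[of _ j] by (auto simp: A'_def T_def)
    next
      case False
      then have "j = Suc n" using that by simp
      then show ?thesis
        using new finite_ball[OF X x] conn_ball[OF X x] qX by (auto simp: h_def)
    qed
    then show "finite (A' j)" "A' j \<subseteq> X" "conn E (A' j)" "v' j \<in> A' j" by auto
  qed
  have adj: "\<exists>y\<in>A' i. \<exists>z\<in>A' (Suc n). E y z" if "i \<le> n" for i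
  proof (intro bexI)
    have "c < h (v i)" using hZ(1)[OF A(5)[OF that]] c R by simp
    then show "E (p i (Suc c)) (p i c)" "p i (Suc c) \<in> A' i" "p i c \<in> A' (Suc n)"
      using pj[OF that] sym that by (auto simp: A'_def T_def)
  qed
  have "rooted_clique_model E \<Delta> X (Suc n) A' v'"
    unfolding rooted_clique_model_def
  proof (intro conjI allI impI ballI)
    fix i j assume ij: "i \<le> Suc n" "j \<le> Suc n" "i \<noteq> j"
    consider "i \<le> n" "j \<le> n" | "i = Suc n" "j \<le> n" | "i \<le> n" "j = Suc n"
      using ij by linarith
    note cases = this
    show "\<exists>x\<in>A' i. \<exists>y\<in>A' j. E x y"
    proof (cases rule: cases)
      case 1
      then show ?thesis using AA(2)[of i j] ij by (auto simp: A'_def)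
    next
      case 2
      then show ?thesis using adj[of j] sym by blast
    qed (use adj in blast)
    show "A' i \<inter> A' j = {}"
    proof (cases rule: cases)
      case 1
      have "y \<notin> T j" if "y \<in> T i" for y
        using TT[OF that _ 1 ij(3), of y] T(1)[OF that 1(1)] by auto
      then show ?thesis
        using 1 AA(1)[of i j] TA[of _ i j] TA[of _ j i] ij(3) by (auto simp: A'_def)
    next
      case 2
      then show ?thesis using hA'[of _ j] new by fastforce
    next
      case 3
      then show ?thesis using hA'[of _ i] new by fastforce
    qed
    show "\<Delta> < hops E X (v' i) y" if y: "y \<in> A' j" for y
    proof (cases rule: cases)
      case 1
      show ?thesis
      proof (cases "y \<in> T j")
        case True
        then show ?thesis using TT[OF v'T(1)[OF 1(1)] True 1 ij(3)] R by simp
      next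
        case False
        then have "y \<in> Z" using y 1 A(2) by (auto simp: A'_def)
        then have "a \<le> h y" "y \<in> X" using hZ ZX by auto
        then show ?thesis
          using tri[OF x v'T(4)[OF 1(1)], of y] v'T(2)[OF 1(1)] c R by (simp add: h_def)
      qed
    next
      case 2
      have "h y \<le> h (v' i) + hops E X (v' i) y"
        using tri[OF x qX(1)] hA'(2)[OF y 2(2)] 2 new by (simp add: h_def)
      then show ?thesis using hA'(1)[OF y 2(2)] 2 new qX(2) c R by simp
    next
      case 3
      then have yX: "y \<in> X" "h y \<le> c" using y new by auto
      have "h (v' i) \<le> h y + hops E X y (v' i)"
        using tri[OF x yX(1) v'T(4)[OF 3(1)]] by (simp add: h_def)
      then show ?thesis using yX v'T(2)[OF 3(1)] hops_sym[of X y "v' i"] R by simp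
    qed
  qed (use fin in auto)
  moreover have "hops E V (v j) (v' j) \<le> 4 * Suc \<Delta>" if "j \<le> n" for j
    using le[OF A(6)[OF that] v'T(4)[OF that]] T(4)[OF v'T(1)[OF that] that] by (simp add: R_def)
  \<comment> \<open>This is where the constant 4 comes from: the geodesic rises from level
    \<open>c - R\<close> to at most \<open>a + \<Delta>\<close>, which is \<open>4 * R - 1\<close>
    steps.\<close>
  moreover have "hops E V u (v' (Suc n)) \<le> 4 * Suc \<Delta>"
  proof -
    have "hops E X (q (c - R)) u \<le> h u - (c - R)"
      using geodesic_hops[OF q, of "c - R" "h u"] q'(1) hZ(1)[OF u] c by (simp add: h_def)
    then show ?thesis
      using hZ(2)[OF u] le[OF uX qX(1)] hops_sym[of X u "q (c - R)"] new c by (simp add: R_def)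
  qed
  ultimately show ?thesis by blast
qed

text \<open>The first chopping is peeled off, the model of the rest is extended, and
  \<open>w (Suc n)\<close> plays the role of \<open>u\<close>. Each level moves a representative by
  at most \<open>4 * Suc \<Delta>\<close> in the metric of \<open>V\<close>. The bound
  \<open>N\<close> stays fixed so that the separation of the \<open>w j\<close> survives the
  induction on \<open>n\<close>.\<close>

lemma iterated_chop_model:
  assumes V: "conn E V" and "(chop E \<Delta> ^^ n) X Y" "conn E X" "X \<subseteq> V" "n \<le> N"
    and w: "\<And>j. j \<le> N \<Longrightarrow> w j \<in> Y"
    and far: "\<And>i j. i \<le> N \<Longrightarrow> j \<le> N \<Longrightarrow> i \<noteq> j \<Longrightarrow> 8 * Suc \<Delta> * Suc N \<le> hops E V (w i) (w j)"
  shows "\<exists>A v. rooted_clique_model E \<Delta> X n A v \<and> (\<forall>j\<le>n. hops E V (w j) (v j) \<le> 4 * Suc \<Delta> * n)"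
  using assms(2-5)
proof (induction n arbitrary: X)
  case 0
  then have "w 0 \<in> X" "w 0 \<in> V" using w by auto
  then show ?case
    by (intro exI[of _ "\<lambda>_. {w 0}"] exI[of _ w])
      (auto simp: rooted_clique_model_def conn_def intro!: exI[of _ 0])
next
  case (Suc n)
  obtain Z where Z: "chop E \<Delta> X Z" "(chop E \<Delta> ^^ n) Z Y"
    using Suc.prems(1) relpowp_Suc_E2 by metis
  have ZX: "Z \<subseteq> X" "conn E Z" using Z(1) by (auto simp: chop_def)
  obtain A v where model: "rooted_clique_model E \<Delta> Z n A v"
    and near: "\<And>j. j \<le> n \<Longrightarrow> hops E V (w j) (v j) \<le> 4 * Suc \<Delta> * n"
    using Suc.IH[OF Z(2)] ZX Suc.prems by (metis Suc_leD order_trans)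
  have wZ: "w j \<in> Z" if "j \<le> N" for j
    using w[OF that] chops_subset[OF Z(2)] by auto
  have vV: "v j \<in> V" if "j \<le> n" for j
    using model that ZX Suc.prems(3) by (auto simp: rooted_clique_model_def)
  have wV: "w j \<in> V" if "j \<le> N" for j
    using wZ that ZX Suc.prems(3) by auto
  define K where "K = Suc \<Delta> * n"
  \<comment> \<open>Two representatives drift by at most \<open>8 * K\<close> together; the
    remaining \<open>16 * Suc \<Delta>\<close> covers the separation \<open>8 * Suc \<Delta>\<close>
    required by the next extension.\<close>
  have "Suc \<Delta> * (n + 2) \<le> Suc \<Delta> * Suc N"
    using Suc.prems(4) by (intro mult_le_mono2) auto
  then have K: "8 * K + 16 * Suc \<Delta> \<le> 8 * Suc \<Delta> * Suc N"
    by (simp add: K_def algebra_simps)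
  have near': "hops E V (w j) (v j) \<le> 4 * K" if "j \<le> n" for j
    using near[OF that] by (simp add: K_def algebra_simps)
  have far1: "8 * Suc \<Delta> \<le> hops E V (v i) (v j)" if "i \<le> n" "j \<le> n" "i \<noteq> j" for i j
  proof -
    have "hops E V (w i) (w j) \<le> hops E V (w i) (v i) + hops E V (v i) (v j) + hops E V (w j) (v j)"
      using hops_triangle[OF V, of "w i" "v i" "w j"] hops_triangle[OF V, of "v i" "v j" "w j"]
        wV[of i] wV[of j] vV that Suc.prems(4) hops_sym[of V "v j" "w j"] by simp
    then show ?thesis
      using far[of i j] K near'[of i] near'[of j] that Suc.prems(4) by linarith
  qed
  have far2: "8 * Suc \<Delta> \<le> hops E V (v 0) (w (Suc n))"
  proof -
    have "hops E V (w 0) (w (Suc n)) \<le> hops E V (w 0) (v 0) + hops E V (v 0) (w (Suc n))"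
      using hops_triangle[OF V] wV vV Suc.prems(4) by simp
    then show ?thesis
      using far[of 0 "Suc n"] K near'[of 0] Suc.prems(4) by linarith
  qed
  obtain A' v' where A': "rooted_clique_model E \<Delta> X (Suc n) A' v'"
    and step: "\<And>j. j \<le> n \<Longrightarrow> hops E V (v j) (v' j) \<le> 4 * Suc \<Delta>"
      "hops E V (w (Suc n)) (v' (Suc n)) \<le> 4 * Suc \<Delta>"
    using rooted_clique_model_extend[OF V Suc.prems(3,2) Z(1) model wZ[OF Suc.prems(4)] far1 far2]
    by blast
  have v'V: "v' j \<in> V" if "j \<le> Suc n" for j
    using A' that Suc.prems(3) by (auto simp: rooted_clique_model_def)
  have "hops E V (w j) (v' j) \<le> 4 * Suc \<Delta> * Suc n" if "j \<le> Suc n" for j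
  proof -
    have "hops E V (w j) (v' j) \<le> 4 * K + 4 * Suc \<Delta>"
    proof (cases "j = Suc n")
      case False
      then have "j \<le> n" using that by simp
      then show ?thesis
        using hops_triangle[OF V, of "w j" "v j" "v' j"] wV[of j] vV[of j] v'V[of j]
          near'[of j] step(1)[of j] Suc.prems(4) by simp
    qed (use step in simp)
    then show ?thesis by (simp add: K_def algebra_simps)
  qed
  with A' show ?case by blast
qed

section \<open>Diameter of iterated choppings\<close>

text \<open>A discrete intermediate value theorem: along a walk, the distance from \<open>p\<close>
  grows by at most one per step.\<close>

lemma hops_intermediate:
  assumes "conn E V" "Y \<subseteq> V" "p \<in> V"
  shows "walk E Y n y q \<Longrightarrow> hops E V p y \<le> k \<Longrightarrow> k \<le> hops E V p q \<Longrightarrow> \<exists>z\<in>Y. hops E V p z = k"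
proof (induction n arbitrary: y)
  case (Suc n)
  show ?case
  proof (cases "hops E V p y = k")
    case True
    then show ?thesis using Suc.prems by auto
  next
    case False
    obtain z where z: "E y z" "walk E Y n z q" and "y \<in> Y"
      using Suc.prems by auto
    then have "walk E V 1 y z"
      using walk_in[OF z(2)] assms by (intro walk_edge) auto
    then have "hops E V p z \<le> k"
      using hops_walk_le[OF assms(1,3)] False Suc.prems(2) by fastforce
    with Suc.IH z Suc.prems show ?thesis by blast
  qed
qed auto

text \<open>A walk in \<open>Y\<close> between points at distance at least \<open>n * D\<close>
  meets every distance \<open>j * D\<close> from \<open>p\<close> with \<open>j \<le> n\<close>.
  This gives \<open>n + 1\<close> points pairwise at least \<open>D\<close> apart, enough to build a
  clique model.\<close>

lemma iterated_chop_diameter: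
  assumes V: "conn E V" and Y: "(chop E \<Delta> ^^ n) V Y" "p \<in> Y" "q \<in> Y"
    and no_model: "\<nexists>A v. rooted_clique_model E \<Delta> V n A v"
  shows "hops E V p q < n * (8 * Suc \<Delta> * Suc n)"
proof (rule ccontr)
  define D where "D = 8 * Suc \<Delta> * Suc n"
  assume "\<not> hops E V p q < n * (8 * Suc \<Delta> * Suc n)"
  then have large: "n * D \<le> hops E V p q" by (simp add: D_def)
  have YV: "Y \<subseteq> V" "conn E Y"
    using chops_subset[OF Y(1)] chops_conn[OF Y(1) V] by auto
  have "\<exists>z\<in>Y. hops E V p z = j * D" if "j \<le> n" for j
  proof (rule hops_intermediate[OF V YV(1) _ hops_walk[OF YV(2) Y(2,3)]])
    show "j * D \<le> hops E V p q"
      using mult_le_mono1[OF that, of D] large by (rule order_trans)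
  qed (use Y YV in auto)
  then obtain w where w: "\<And>j. j \<le> n \<Longrightarrow> w j \<in> Y \<and> hops E V p (w j) = j * D"
    by metis
  have less: "D \<le> hops E V (w i) (w j)" if "i < j" "j \<le> n" for i j
  proof -
    have "j * D \<le> i * D + hops E V (w i) (w j)"
      using hops_triangle[OF V, of p "w i" "w j"] w[of i] w[of j] that Y(2) YV by auto
    moreover have "Suc i * D \<le> j * D" using that by (intro mult_le_mono1) auto
    ultimately show ?thesis by simp
  qed
  have "8 * Suc \<Delta> * Suc n \<le> hops E V (w i) (w j)" if "i \<le> n" "j \<le> n" "i \<noteq> j" for i j
    using less[of i j] less[of j i] that hops_sym[of V "w i" "w j"]
    by (cases "i < j") (auto simp: D_def)
  with iterated_chop_model[OF V Y(1) V subset_refl le_refl, of w] w no_model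
  show False by blast
qed

section \<open>The pieces: multiplicity, Lebesgue number and the resulting cover\<close>

lemma conn_component: "conn E (component E X x)"
proof (rule conn_if_centre[of _ x])
  fix y assume "y \<in> component E X x"
  then obtain n where n: "walk E X n x y" by (auto simp: component_def)
  then have "walk E (component E X x) n x y"
    by (rule walk_range) (auto simp: component_def)
  then show "\<exists>n. walk E (component E X x) n x y" ..
qed

lemma component_subset: "component E X x \<subseteq> X"
  by (auto simp: component_def dest: walk_in)

lemma component_self: "x \<in> X \<Longrightarrow> x \<in> component E X x"
  by (auto simp: component_def intro!: exI[of _ 0])

lemma component_eq:
  assumes "y \<in> component E X x"
  shows "component E X x = component E X y"
proof -
  obtain k where k: "walk E X k x y"
    using assms by (auto simp: component_def)
  show ?thesis
    unfolding component_def using walk_append[OF k] walk_append[OF walk_sym[OF k]] by blast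
qed

text \<open>Nonemptiness is carried through the induction because the root of a piece is chosen by
  \<open>SOME\<close>.\<close>

lemma pieces_chop:
  assumes "conn E V" "V \<noteq> {}"
  shows "Y \<in> pieces E V \<sigma> n \<Longrightarrow> (chop E (2 * \<sigma> - 1) ^^ n) V Y \<and> Y \<noteq> {}"
proof (induction n arbitrary: Y)
  case (Suc n)
  then obtain X k y where X: "X \<in> pieces E V \<sigma> n" and y: "y \<in> annulus E X \<sigma> k"
    and Y: "Y = component E (annulus E X \<sigma> k) y"
    by auto
  have IH: "(chop E (2 * \<sigma> - 1) ^^ n) V X" "X \<noteq> {}"
    using Suc.IH[OF X] by auto
  define x where "x = (SOME x. x \<in> X)"
  have x: "x \<in> X"
    unfolding x_def using IH(2) by (simp add: some_in_eq)
  have ann: "z \<in> annulus E X \<sigma> k \<longleftrightarrow> z \<in> X \<and> hops E X x z \<in> {k * \<sigma>..k * \<sigma> + (2 * \<sigma> - 1)}" for z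
    by (simp add: annulus_def x_def)
  have Ya: "Y \<subseteq> annulus E X \<sigma> k"
    unfolding Y by (rule component_subset)
  have closed: "z \<in> Y" if uY: "u \<in> Y" and "E u z" "z \<in> annulus E X \<sigma> k" for u z
  proof -
    have "walk E (annulus E X \<sigma> k) 1 u z"
      using that Ya by (intro walk_edge) auto
    moreover obtain n where "walk E (annulus E X \<sigma> k) n y u"
      using uY by (auto simp: Y component_def)
    ultimately have "walk E (annulus E X \<sigma> k) (n + 1) y z"
      using walk_append by metis
    then show ?thesis
      unfolding Y component_def by blast
  qed
  have "chop E (2 * \<sigma> - 1) X Y"
    unfolding chop_def
  proof (intro conjI bexI[OF _ x] exI[of _ "k * \<sigma>"] ballI impI)
    show "conn E Y" unfolding Y by (rule conn_component)
  qed (use Ya ann closed in blast)+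
  with IH(1) have "(chop E (2 * \<sigma> - 1) ^^ Suc n) V Y"
    by auto
  moreover have "Y \<noteq> {}"
    unfolding Y using component_self[OF y] by auto
  ultimately show ?case ..
qed (use assms in auto)

text \<open>A piece containing \<open>q\<close> is determined by its parent, which also contains
  \<open>q\<close>, and by one of at most two annuli through \<open>q\<close>.\<close>

lemma pieces_multiplicity:
  assumes "0 < \<sigma>"
  shows "finite {Y\<in>pieces E V \<sigma> n. q \<in> Y} \<and> card {Y\<in>pieces E V \<sigma> n. q \<in> Y} \<le> 2 ^ n"
proof (induction n)
  case 0
  have "{Y\<in>pieces E V \<sigma> 0. q \<in> Y} \<subseteq> {V}" by auto
  then show ?case
    using card_mono[of "{V}"] finite_subset[of _ "{V}"] by auto
next
  case (Suc n)
  define S where "S = {X\<in>pieces E V \<sigma> n. q \<in> X}"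
  \<comment> \<open>The index of an annulus through \<open>q\<close> is the quotient by \<sigma> or
    one less. At quotient 0 truncation identifies both choices, which is harmless since only an
    upper bound is needed.\<close>
  define f where "f = (\<lambda>(X, b). component E (annulus E X \<sigma> (hops E X (SOME x. x \<in> X) q div \<sigma> - b)) q)"
  have sub: "{Y\<in>pieces E V \<sigma> (Suc n). q \<in> Y} \<subseteq> f ` (S \<times> {0, 1})"
  proof
    fix Y assume "Y \<in> {Y\<in>pieces E V \<sigma> (Suc n). q \<in> Y}"
    then obtain X k y where X: "X \<in> pieces E V \<sigma> n" and Y: "Y = component E (annulus E X \<sigma> k) y"
      and q: "q \<in> component E (annulus E X \<sigma> k) y"
      by auto
    have qa: "q \<in> annulus E X \<sigma> k"
      using q component_subset by blast
    define h where "h = hops E X (SOME x. x \<in> X) q"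
    have h: "k * \<sigma> \<le> h" "h < (k + 2) * \<sigma>"
      using qa assms by (auto simp: annulus_def h_def algebra_simps)
    then have "k \<le> h div \<sigma>" "h div \<sigma> < k + 2"
      using assms by (auto simp: less_eq_div_iff_mult_less_eq div_less_iff_less_mult)
    moreover define b where "b = h div \<sigma> - k"
    ultimately have b: "k = h div \<sigma> - b" "b \<in> {0, 1}"
      by auto
    have "Y = f (X, b)"
      using component_eq[OF q] b(1) by (simp add: Y f_def h_def)
    moreover have "X \<in> S"
      using X qa by (auto simp: S_def annulus_def)
    ultimately show "Y \<in> f ` (S \<times> {0, 1})"
      using b(2) by blast
  qed
  have S: "finite S" "card S \<le> 2 ^ n"
    using Suc by (auto simp: S_def)
  then have "finite (S \<times> {0, 1::nat})" "card (S \<times> {0, 1::nat}) \<le> 2 ^ Suc n"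
    by (auto simp: card_cartesian_product)
  with sub show ?case
    using surj_card_le[OF _ sub] finite_surj[OF _ sub] by linarith
qed

text \<open>Overlapping annuli keep the Lebesgue number: an \<open>s\<close>-ball inside \<open>X\<close> spans \<open>2s\<close> consecutive
  distances from the root of \<open>X\<close>, hence fits into one annulus.\<close>

lemma pieces_lebesgue:
  assumes V: "conn E V" and x: "x \<in> V" and \<sigma>: "0 < \<sigma>" "2 * s \<le> \<sigma>"
  shows "\<exists>Y\<in>pieces E V \<sigma> n. {y\<in>V. hops E V x y \<le> s} \<subseteq> Y"
proof (induction n)
  case (Suc n)
  define B where "B = {y\<in>V. hops E V x y \<le> s}"
  obtain X where X: "X \<in> pieces E V \<sigma> n" and BX: "B \<subseteq> X"
    using Suc unfolding B_def by auto
  have cX: "conn E X"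
    using pieces_chop[OF V _ X] chops_conn V x by blast
  have xB: "x \<in> B" using x by (simp add: B_def)
  define r where "r = (SOME x. x \<in> X)"
  have r: "r \<in> X"
    unfolding r_def using BX xB by (intro someI_ex[of "\<lambda>x. x \<in> X"]) auto
  \<comment> \<open>Distances may grow in the subset \<open>X\<close>, but these walks run inside
    \<open>B\<close>, so they survive in every set containing \<open>B\<close>.\<close>
  have walk_B: "\<exists>k\<le>s. walk E B k x y" if "y \<in> B" for y
  proof -
    have "walk E V (hops E V x y) x y" and le: "hops E V x y \<le> s"
      using that hops_walk[OF V x] by (auto simp: B_def)
    then have "walk E B (hops E V x y) x y"
    proof (rule_tac walk_range)
      fix k z assume "k \<le> hops E V x y" "walk E V k x z"
      then show "z \<in> B"
        using le hops_le[of E V k x z] walk_in[of E V k x z] by (auto simp: B_def)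
    qed
    with le show ?thesis by blast
  qed
  define c where "c = hops E X r x"
  \<comment> \<open>The annulus starting at or just below the lowest layer the ball can reach.
    Truncation at 0 for \<open>c < s\<close> keeps both estimates valid.\<close>
  define k where "k = (c - s) div \<sigma>"
  have "(c - s) = k * \<sigma> + (c - s) mod \<sigma>" "(c - s) mod \<sigma> < \<sigma>"
    using \<sigma> by (auto simp: k_def)
  then have k: "k * \<sigma> \<le> c - s" "c + s \<le> k * \<sigma> + (2 * \<sigma> - 1)"
    using \<sigma> by linarith+
  have B_ann: "B \<subseteq> annulus E X \<sigma> k"
  proof
    fix y assume y: "y \<in> B"
    then obtain j where j: "j \<le> s" "walk E X j x y"
      using walk_B walk_mono[OF _ BX] by blast
    have "hops E X r y \<le> c + j"
      using hops_walk_le[OF cX r j(2)] by (simp add: c_def)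
    moreover have "c \<le> hops E X r y + j"
      using hops_walk_le[OF cX r walk_sym[OF j(2)]] by (simp add: c_def)
    ultimately have "hops E X r y \<in> {k * \<sigma>..k * \<sigma> + (2 * \<sigma> - 1)}"
      using k j(1) by auto
    then show "y \<in> annulus E X \<sigma> k"
      using y BX by (auto simp: annulus_def r_def)
  qed
  have "B \<subseteq> component E (annulus E X \<sigma> k) x"
    using walk_B walk_mono[OF _ B_ann] unfolding component_def by blast
  moreover have "component E (annulus E X \<sigma> k) x \<in> pieces E V \<sigma> (Suc n)"
    using X B_ann xB by auto
  ultimately show ?case
    unfolding B_def by blast
qed auto

lemma exists_bounded_cover:
  assumes V: "conn E V" "V \<noteq> {}" and s: "0 < s"
    and no_model: "\<And>\<Delta>. \<nexists>A v. rooted_clique_model E \<Delta> V n A v"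
  shows "\<exists>\<U>. \<Union>\<U> = V \<and>
    (\<forall>x\<in>V. finite {U\<in>\<U>. \<exists>y\<in>U. hops E V x y \<le> s} \<and> card {U\<in>\<U>. \<exists>y\<in>U. hops E V x y \<le> s} \<le> 2 ^ n) \<and>
    (\<forall>U\<in>\<U>. \<forall>x\<in>U. \<forall>y\<in>U. hops E V x y \<le> 32 * n * Suc n * s)"
proof -
  define P where "P = pieces E V (2 * s) n"
  \<comment> \<open>A ball around \<open>x\<close> of radius \<open>s\<close> can meet
    \<open>core Y\<close> only if \<open>x\<close> lies in \<open>Y\<close>, so ball multiplicity
    reduces to point multiplicity.\<close>
  define core where "core Y = {x\<in>V. {y\<in>V. hops E V x y \<le> s} \<subseteq> Y}" for Y
  have core: "x \<in> Y" if "y \<in> core Y" "x \<in> V" "hops E V x y \<le> s" for x y Y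
    using that hops_sym[of V x y] by (auto simp: core_def)
  have self: "core Y \<subseteq> Y" for Y
    by (auto simp: core_def)
  have "\<Union>(core ` P) = V"
    using pieces_lebesgue[OF V(1), of _ "2 * s" s n] s by (fastforce simp: core_def P_def)
  moreover have "finite {U\<in>core ` P. \<exists>y\<in>U. hops E V x y \<le> s} \<and>
      card {U\<in>core ` P. \<exists>y\<in>U. hops E V x y \<le> s} \<le> 2 ^ n" if "x \<in> V" for x
  proof -
    define Q where "Q = {Y\<in>P. x \<in> Y}"
    have Q: "finite Q" "card Q \<le> 2 ^ n"
      using pieces_multiplicity[of "2 * s" V n x] s by (auto simp: Q_def P_def)
    have "{U\<in>core ` P. \<exists>y\<in>U. hops E V x y \<le> s} \<subseteq> core ` Q"
      using core that by (auto simp: Q_def)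
    then have "finite {U\<in>core ` P. \<exists>y\<in>U. hops E V x y \<le> s}"
      "card {U\<in>core ` P. \<exists>y\<in>U. hops E V x y \<le> s} \<le> card Q"
      using Q(1) by (auto intro: surj_card_le elim: finite_subset)
    with Q(2) show ?thesis by linarith
  qed
  moreover have "hops E V x y \<le> 32 * n * Suc n * s" if UP: "U \<in> core ` P" "x \<in> U" "y \<in> U" for U x y
  proof -
    obtain Y where "Y \<in> P" "x \<in> Y" "y \<in> Y" using UP self by blast
    \<comment> \<open>With \<sigma> equal to \<open>2 * s\<close>, the annuli have
      \<open>4 * s\<close> layers, which turns the constant 8 into 32.\<close>
    moreover have "Suc (2 * (2 * s) - 1) = 4 * s" using s by simp
    ultimately have "hops E V x y < n * (8 * (4 * s) * Suc n)"
      using iterated_chop_diameter[OF V(1) _ _ _ no_model, of "2 * (2 * s) - 1" Y x y] pieces_chop[OF V, of Y "2 * s" n]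
      unfolding P_def by presburger
    then show ?thesis by (simp add: algebra_simps)
  qed
  ultimately show ?thesis by blast
qed

end

section \<open>Transfer between relations and graphs\<close>

lemma reachable_if_walk:
  assumes "wf_digraph H" "walk E X n x y" "X \<subseteq> verts H"
    and "\<And>x y. x \<in> X \<Longrightarrow> y \<in> X \<Longrightarrow> E x y \<Longrightarrow> x \<rightarrow>\<^bsub>H\<^esub> y"
  shows "x \<rightarrow>\<^sup>*\<^bsub>H\<^esub> y"
  using assms(2)
proof (induction n arbitrary: x)
  case 0
  then show ?case
    using assms(1,3) wf_digraph.reachable_refl by fastforce
next
  case (Suc n)
  then obtain z where "E x z" "walk E X n z y" "x \<in> X" by auto
  then show ?case
    using Suc.IH assms(4)[of x z] walk_in[of E X n z y] wf_digraph.adj_reachable_trans[OF assms(1)] by metis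
qed

lemma (in wf_digraph) walk_iff_awalk:
  "walk (dominates G) (verts G) n u v \<longleftrightarrow> (\<exists>p. awalk u p v \<and> length p = n)"
proof (induction n arbitrary: u)
  case 0
  then show ?case by (auto simp: awalk_Nil_iff)
next
  case (Suc n)
  have "(\<exists>p. awalk u p v \<and> length p = Suc n) \<longleftrightarrow> (\<exists>e p. awalk u (e # p) v \<and> length p = n)"
    by (auto simp: length_Suc_conv)
  also have "\<dots> \<longleftrightarrow> u \<in> verts G \<and> (\<exists>z. u \<rightarrow>\<^bsub>G\<^esub> z \<and> (\<exists>p. awalk z p v \<and> length p = n))"
    by (auto simp: awalk_Cons_iff arcs_ends_conv)
  finally show ?case
    using Suc by simp
qed

lemma (in wf_digraph) graph_dist_eq_hops:
  assumes "conn (dominates G) (verts G)" "u \<in> verts G" "v \<in> verts G"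
  shows "graph_dist G u v = hops (dominates G) (verts G) u v"
proof -
  obtain p where p: "awalk u p v" "length p = hops (dominates G) (verts G) u v"
    using hops_walk[OF assms] walk_iff_awalk by blast
  then have "u \<rightarrow>\<^sup>* v" by (auto simp: reachable_awalk)
  then obtain q where q: "awalk u q v" "graph_dist G u v = length q"
    using graph_dist_attained by blast
  then have "hops (dominates G) (verts G) u v \<le> length q"
    using walk_iff_awalk by (intro hops_le) blast
  with graph_dist_le[OF p(1)] p(2) q(2) show ?thesis by simp
qed

context simple_graph
begin

lemma locally_finite_dominates:
  assumes "\<forall>v\<in>verts G. finite (out_arcs G v)"
  shows "locally_finite_relation (dominates G)"
proof
  show "y \<rightarrow>\<^bsub>G\<^esub> x" if "x \<rightarrow>\<^bsub>G\<^esub> y" for x y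
    using that sym_arcs by (auto simp: symmetric_def elim: symE)
  show "finite {y. x \<rightarrow>\<^bsub>G\<^esub> y}" for x
  proof (cases "x \<in> verts G")
    case True
    have "{y. x \<rightarrow>\<^bsub>G\<^esub> y} \<subseteq> head G ` out_arcs G x"
      by (auto simp: arcs_ends_conv)
    then show ?thesis
      using assms True by (auto elim: finite_surj[rotated])
  next
    case False
    then have "{y. x \<rightarrow>\<^bsub>G\<^esub> y} = {}" by (auto dest: adj_in_verts)
    then show ?thesis by simp
  qed
qed

lemma conn_verts:
  assumes "Digraph_Component.connected G"
  shows "conn (dominates G) (verts G)"
  using symmetric_connected_imp_strongly_connected[OF sym_arcs assms]
  by (auto simp: conn_def strongly_connected_def walk_iff_awalk reachable_awalk)

lemma graph_induce_subgraph:
  assumes "finite A" "A \<subseteq> verts G"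
  shows "graph (G \<restriction> A)"
proof -
  interpret H: wf_digraph "G \<restriction> A" by (rule wellformed_induce_subgraph)
  \<comment> \<open>Without parallel arcs, the arcs embed into \<open>A \<times> A\<close>, so
    finitely many vertices leave finitely many arcs.\<close>
  have "inj_on (arc_to_ends G) (arcs (G \<restriction> A))"
    using inj_on_arc_to_ends by (rule inj_on_subset) auto
  moreover have "arc_to_ends G ` arcs (G \<restriction> A) \<subseteq> A \<times> A"
    by (auto simp: arc_to_ends_def)
  ultimately have "finite (arcs (G \<restriction> A))"
    using assms(1) by (meson finite_SigmaI inj_on_finite)
  moreover have "symmetric (G \<restriction> A)"
  proof -
    have "b \<rightarrow>\<^bsub>G \<restriction> A\<^esub> a" if ab: "a \<rightarrow>\<^bsub>G \<restriction> A\<^esub> b" for a b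
    proof -
      have "a \<in> A" "b \<in> A" "a \<rightarrow>\<^bsub>G\<^esub> b" using ab by (auto simp: arcs_ends_conv)
      moreover have "b \<rightarrow>\<^bsub>G\<^esub> a" using \<open>a \<rightarrow>\<^bsub>G\<^esub> b\<close> sym_arcs by (auto simp: symmetric_def elim: symE)
      ultimately show ?thesis by (auto simp: arcs_ends_conv image_iff)
    qed
    then show ?thesis by (auto simp: symmetric_def intro: symI)
  qed
  ultimately show ?thesis
    using assms(1) no_loops no_multi_arcs by unfold_locales (auto simp: arc_to_ends_def)
qed

lemma connected_induce_subgraph:
  assumes "conn (dominates G) A" "A \<subseteq> verts G" "A \<noteq> {}"
  shows "Digraph_Component.connected (G \<restriction> A)"
proof -
  interpret H: wf_digraph "G \<restriction> A" by (rule wellformed_induce_subgraph)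
  have "x \<rightarrow>\<^sup>*\<^bsub>G \<restriction> A\<^esub> y" if xy: "x \<in> A" "y \<in> A" for x y
  proof -
    obtain n where "walk (dominates G) A n x y"
      using assms(1) xy unfolding conn_def by blast
    then show ?thesis
      by (rule reachable_if_walk[OF H.wf_digraph]) (auto simp: arcs_ends_conv image_iff)
  qed
  then show ?thesis
    unfolding Digraph_Component.connected_def using assms(3)
    by (intro strongly_connectedI H.reachable_mk_symmetricI) auto
qed

lemma complete_graph_minor:
  assumes "rooted_clique_model (dominates G) \<Delta> (verts G) n A v"
  shows "minor (with_proj (complete_graph (Suc n))) G"
proof -
  have A: "finite (A j)" "A j \<subseteq> verts G" "conn (dominates G) (A j)" "A j \<noteq> {}" if "j \<le> n" for j
    using assms that by (auto simp: rooted_clique_model_def)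
  have AA: "A i \<inter> A j = {}" "\<exists>x\<in>A i. \<exists>y\<in>A j. x \<rightarrow>\<^bsub>G\<^esub> y" if "i \<le> n" "j \<le> n" "i \<noteq> j" for i j
    using assms that by (auto simp: rooted_clique_model_def)
  show ?thesis
    unfolding minor_def
  proof (intro exI[of _ "\<lambda>j. G \<restriction> A j"] conjI ballI allI impI)
    fix j assume "j \<in> verts (with_proj (complete_graph (Suc n)))"
    then have j: "j \<le> n" by (auto simp: complete_graph_def)
    show "subgraph (G \<restriction> A j) G"
      using A[OF j] by (intro induced_imp_subgraph induced_induce)
    show "graph (G \<restriction> A j)" "Digraph_Component.connected (G \<restriction> A j)"
      using A[OF j] graph_induce_subgraph connected_induce_subgraph by auto
  qed (use AA in \<open>auto simp: complete_graph_def arcs_ends_conv\<close>)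
qed

end

section \<open>From integer radii to all real radii\<close>

theorem theorem2p2:
  fixes m :: nat and G :: "('a, 'b) pre_digraph"
  assumes "simple_graph G"
    and "Digraph_Component.connected G"
    and "\<forall>v\<in>verts G. finite (out_arcs G v)"
    and "\<not> minor (with_proj (complete_graph m)) G"
  shows "Metric_space.assouad_nagata_dim_le (verts G) (graph_dist G) (4 ^ m - 1)"
proof -
  interpret simple_graph G by (rule assms(1))
  interpret Metric_space "verts G" "graph_dist G"
    by (rule Metric_space_graph_dist[OF assms(2)])
  define E where "E = dominates G"
  interpret locally_finite_relation E
    unfolding E_def by (rule locally_finite_dominates[OF assms(3)])
  have cG: "conn E (verts G)" and nG: "verts G \<noteq> {}"
    using conn_verts[OF assms(2)] assms(2) by (auto simp: E_def Digraph_Component.connected_def strongly_connected_def)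
  have dist: "graph_dist G x y = hops E (verts G) x y" if "x \<in> verts G" "y \<in> verts G" for x y
    using graph_dist_eq_hops cG that by (simp add: E_def)
  \<comment> \<open>The graph with no vertices is a minor of every graph, all conditions being
    vacuous.\<close>
  have "m \<noteq> 0"
    using assms(4) by (auto simp: minor_def complete_graph_def)
  then obtain n where m: "m = Suc n"
    using not0_implies_Suc by blast
  have no_model: "\<nexists>A v. rooted_clique_model E \<Delta> (verts G) n A v" for \<Delta>
    using assms(4) complete_graph_minor unfolding m E_def by blast
  have pow: "(2::nat) ^ n \<le> 4 ^ m - 1 + 1"
  proof -
    have "(2::nat) ^ n \<le> 4 ^ n" by (rule power_mono) auto
    also have "\<dots> \<le> 4 ^ m" by (simp add: m)
    finally show ?thesis by simp
  qed
  \<comment> \<open>The summand 1 keeps \<gamma> positive when \<open>n = 0\<close>.\<close>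
  define \<gamma> where "\<gamma> = real (32 * n * Suc n + 1)"
  show ?thesis
    unfolding assouad_nagata_dim_le_def
  proof (intro exI[of _ \<gamma>] conjI allI impI)
    fix s :: real assume s: "s > 0"
    show "\<exists>\<U>. \<Union>\<U> = verts G \<and>
      (\<forall>x\<in>verts G. finite {U\<in>\<U>. U \<inter> mcball x s \<noteq> {}} \<and>
              card {U\<in>\<U>. U \<inter> mcball x s \<noteq> {}} \<le> 4 ^ m - 1 + 1) \<and>
      (\<forall>U\<in>\<U>. \<forall>x\<in>U. \<forall>y\<in>U. graph_dist G x y \<le> \<gamma> * s)"
    \<comment> \<open>Below 1 the balls are single vertices, and the cover by singletons has
      diameter 0, so the linear bound holds for arbitrarily small \<open>s\<close>.\<close>
    proof (cases "s < 1")
      case True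
      have ball: "mcball x s = {x}" if "x \<in> verts G" for x
      proof -
        have "y = x" if y: "y \<in> mcball x s" for y
        proof -
          have "real (hops E (verts G) x y) < 1" "y \<in> verts G"
            using y True dist[OF \<open>x \<in> verts G\<close>, of y] by (auto simp: mcball_def)
          then show ?thesis
            using hops_eq_0[OF cG \<open>x \<in> verts G\<close>, of y] by simp
        qed
        then show ?thesis
          using that s by auto
      qed
      define \<U> where "\<U> = (\<lambda>x. {x}) ` verts G"
      have "finite {U\<in>\<U>. U \<inter> mcball x s \<noteq> {}} \<and>
          card {U\<in>\<U>. U \<inter> mcball x s \<noteq> {}} \<le> 4 ^ m - 1 + 1" if x: "x \<in> verts G" for x
      proof -
        have "{U\<in>\<U>. U \<inter> mcball x s \<noteq> {}} = {{x}}"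
          using ball[OF x] x by (auto simp: \<U>_def)
        then show ?thesis by simp
      qed
      moreover have "graph_dist G x y \<le> \<gamma> * s" if "U \<in> \<U>" "x \<in> U" "y \<in> U" for U x y
        using that s by (auto simp: \<U>_def \<gamma>_def)
      moreover have "\<Union>\<U> = verts G"
        by (auto simp: \<U>_def)
      ultimately show ?thesis by blast
    next
      case False
      \<comment> \<open>Distances are integers, so the ball of radius \<open>s\<close> is the ball
        of radius \<open>k\<close>, and \<open>k \<le> s\<close> keeps the diameter bound linear in
        \<open>s\<close>.\<close>
      define k where "k = nat \<lfloor>s\<rfloor>"
      have k: "0 < k" "real k \<le> s" "\<And>i. real i \<le> s \<longleftrightarrow> i \<le> k"
        using False by (auto simp: k_def le_nat_iff le_floor_iff)
      obtain \<U> where U: "\<Union>\<U> = verts G"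
        and mult: "\<And>x. x \<in> verts G \<Longrightarrow> finite {U\<in>\<U>. \<exists>y\<in>U. hops E (verts G) x y \<le> k} \<and>
          card {U\<in>\<U>. \<exists>y\<in>U. hops E (verts G) x y \<le> k} \<le> 2 ^ n"
        and diam: "\<And>U x y. U \<in> \<U> \<Longrightarrow> x \<in> U \<Longrightarrow> y \<in> U \<Longrightarrow> hops E (verts G) x y \<le> 32 * n * Suc n * k"
        using exists_bounded_cover[OF cG nG k(1) no_model] by (elim exE conjE) blast
      have "finite {U\<in>\<U>. U \<inter> mcball x s \<noteq> {}} \<and>
          card {U\<in>\<U>. U \<inter> mcball x s \<noteq> {}} \<le> 4 ^ m - 1 + 1" if x: "x \<in> verts G" for x
      proof -
        have "y \<in> mcball x s \<longleftrightarrow> hops E (verts G) x y \<le> k" if "U \<in> \<U>" "y \<in> U" for U y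
        proof -
          have "y \<in> verts G" using that U by blast
          then show ?thesis
            using x dist[OF x] k(3) by (simp add: mcball_def)
        qed
        then have "{U\<in>\<U>. U \<inter> mcball x s \<noteq> {}} = {U\<in>\<U>. \<exists>y\<in>U. hops E (verts G) x y \<le> k}"
          by blast
        then show ?thesis
          using mult[OF x] pow by simp
      qed
      moreover have "graph_dist G x y \<le> \<gamma> * s" if "U \<in> \<U>" "x \<in> U" "y \<in> U" for U x y
      proof -
        have "x \<in> verts G" "y \<in> verts G"
          using that U by blast+
        then have "graph_dist G x y \<le> real (32 * n * Suc n * k)"
          using diam[OF that] by (simp only: dist of_nat_le_iff)
        also have "\<dots> = real (32 * n * Suc n) * real k" by simp
        also have "\<dots> \<le> \<gamma> * s"
          using k(2) s by (intro mult_mono) (auto simp: \<gamma>_def)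
        finally show ?thesis .
      qed
      ultimately show ?thesis using U by blast
    qed
  qed (simp add: \<gamma>_def add_pos_nonneg)
qed

end
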